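(* Consider applying the algorithm in the context (with parameters $\alpha,\beta,\gamma,\delta$) to the problem $\min_{x\in\mathbb{R}^d}\frac1n\sum_{i=1}^nf_i(x)$, and suppose that the function assumption and the graph assumption stated in the context hold with $0<m<L$ and $0\le\sigma<1$. Let $\kappa=L/m$, define $\eta=1+\rho-\kappa(1-\rho)$, and choose the parameters $$\alpha=\frac{1-\rho}{m},\qquad\gamma=1+\beta,\qquad\delta=1,$$ where $\beta\in\mathbb{R}$ and $\rho\in\bigl[\frac{L-m}{L+m},1\bigr)$ satisfy the constraints $$\bigl(2\beta-(1-\rho)(\kappa+1)\bigr)\bigl(\beta-1+\rho^2\bigr)<0$$ and $$\rho^2\left(\frac{\beta-1+\rho^2}{\beta-1+\rho}\right)\left(\frac{2-\eta-2\beta}{2\rho^2\beta-(1-\rho^2)\eta}\right)\left(\frac{(2\rho^2+\eta)\beta-(1-\rho^2)\eta}{(1+\rho)(\eta-2\eta\rho+2\rho^2)-(2\rho^2+\eta)\beta}\right)=\sigma^2$$ (the left-hand side being well defined). Then there exists a constant $c>0$ independent of $i$ and $k$ such that for all agents $i\in\{1,\dots,n\}$ and all iterations $k\ge0$, $$\|y_i^k-y_{\mathrm{opt}}\|\le c\,\rho^k,$$ where $y_{\mathrm{opt}}\in\mathbb{R}^d$ is the optimizer of $\min_{x\in\mathbb{R}^d}\frac1n\sum_{i=1}^nf_i(x)$.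
   Context: **Function assumption.** Each $f_i:\mathbb{R}^d\to\mathbb{R}$ is continuously differentiable, and for every $i$ and every $y\in\mathbb{R}^d$, $$\bigl(\nabla f_i(y)-\nabla f_i(y_{\mathrm{opt}})-m(y-y_{\mathrm{opt}})\bigr)^{\mathsf T}\bigl(\nabla f_i(y)-\nabla f_i(y_{\mathrm{opt}})-L(y-y_{\mathrm{opt}})\bigr)\le0,$$ where $y_{\mathrm{opt}}\in\mathbb{R}^d$ satisfies $\sum_{i=1}^n\nabla f_i(y_{\mathrm{opt}})=0$. **Graph assumption.** $1_n\in\mathbb{R}^n$ is the all-ones vector and $\Pi=\frac1n1_n1_n^{\mathsf T}$. At each iteration $k$ there is a graph $\mathcal{G}^k=(\{1,\dots,n\},\mathcal{E}^k)$, where $\mathcal E^k$ is the set of pairs of connected agents. An associated Laplacian matrix $\mathcal{L}^k\in\mathbb{R}^{n\times n}$ satisfies $\mathcal{L}^k1_n=0$ and $\mathcal{L}^k_{ij}=0$ whenever $i\ne j$ and $(i,j)\notin\mathcal{E}^k$. For every $k$: (1) the graph is connected (there is a path between any two nodes) and the zero eigenvalue of $\mathcal{L}^k$ has multiplicity one; (2) the graph is balanced: $1_n^{\mathsf T}\mathcal{L}^k=0$; (3) $\|I-\Pi-\mathcal{L}^k\|\le\sigma$ in spectral norm, where $\sigma$ is independent of $k$. **Algorithm.** Initialization: agents $i\in\{1,\dots,n\}$ choose $x_i^0\in\mathbb{R}^d$ arbitrarily and $w_i^0\in\mathbb{R}^d$ such that $\sum_{i=1}^nw_i^0=0$. For $k=0,1,2,\dots$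 and each agent $i$: $$v_i^k=\sum_{j=1}^n\mathcal{L}^k_{ij}x_j^k,\qquad y_i^k=x_i^k-\delta v_i^k,\qquad u_i^k=\nabla f_i(y_i^k),$$ $$x_i^{k+1}=x_i^k+\beta w_i^k-\alpha u_i^k-\gamma v_i^k,\qquad w_i^{k+1}=w_i^k-v_i^k .$$ *)

theory Defs
  imports "HOL-Analysis.Analysis" "HOL-Computational_Algebra.Polynomial"
begin

(* Meaningful only where f has a gradient; see grad_eqI. *)
definition grad :: "('a::real_inner \<Rightarrow> real) \<Rightarrow> 'a \<Rightarrow> 'a" where
  "grad f x = (THE D. GDERIV f x :> D)"

lemma grad_eqI:
  assumes "GDERIV f x :> D"
  shows "grad f x = D"
  unfolding grad_def
proof (rule the_equality)
  fix D' assume "GDERIV f x :> D'"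
  then have "(\<lambda>h. inner h D') = (\<lambda>h. inner h D)"
    using assms unfolding gderiv_def by (rule has_derivative_unique)
  then have "inner (D' - D) D' = inner (D' - D) D"
    by (rule fun_cong)
  then have "inner (D' - D) (D' - D) = 0"
    by (simp only: inner_diff_right)
  then show "D' = D" by simp
qed (rule assms)

definition continuously_differentiable :: "('a::real_inner \<Rightarrow> real) \<Rightarrow> bool" where
  "continuously_differentiable f \<longleftrightarrow>
     (\<forall>x. \<exists>D. GDERIV f x :> D) \<and> continuous_on UNIV (grad f)"

definition function_assumption ::
    "real \<Rightarrow> real \<Rightarrow> ('n::finite \<Rightarrow> real ^ 'd \<Rightarrow> real) \<Rightarrow> real ^ 'd \<Rightarrow> bool" where
  "function_assumption m L f y_opt \<longleftrightarrow>
     (\<forall>i. continuously_differentiable (f i)) \<and>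
     (\<Sum>i\<in>UNIV. grad (f i) y_opt) = 0 \<and>
     (\<forall>i y. (grad (f i) y - grad (f i) y_opt - m *\<^sub>R (y - y_opt)) \<bullet>
            (grad (f i) y - grad (f i) y_opt - L *\<^sub>R (y - y_opt)) \<le> 0)"

definition averaging_matrix :: "real ^ 'n ^ 'n" where
  "averaging_matrix = (\<chi> i j. 1 / real CARD('n::finite))"

(* Operator norm for the Euclidean norm, i.e. the largest singular value. *)
definition spectral_norm :: "real ^ 'n ^ 'm \<Rightarrow> real" where
  "spectral_norm A = onorm (\<lambda>x. A *v x)"

(* det (X I - A), computed over the ring of real polynomials. *)
definition charpoly :: "real ^ 'n ^ 'n \<Rightarrow> real poly" where
  "charpoly A = det (\<chi> i j. (if i = j then [:0, 1:] else 0) - [:A $ i $ j:])"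

definition associated_laplacian :: "('n \<times> 'n) set \<Rightarrow> real ^ 'n ^ 'n \<Rightarrow> bool" where
  "associated_laplacian E Lap \<longleftrightarrow>
     Lap *v vec 1 = 0 \<and>
     (\<forall>i j. i \<noteq> j \<and> (i, j) \<notin> E \<longrightarrow> Lap $ i $ j = 0)"

(* Edges are ordered pairs; an undirected graph is the case of a symmetric relation.
   The multiplicity of the eigenvalue 0 is the algebraic one. *)
definition graph_assumption ::
    "real \<Rightarrow> (nat \<Rightarrow> ('n \<times> 'n) set) \<Rightarrow> (nat \<Rightarrow> real ^ 'n ^ 'n) \<Rightarrow> bool" where
  "graph_assumption \<sigma> E Lap \<longleftrightarrow>
     (\<forall>k. associated_laplacian (E k) (Lap k) \<and>
          (\<forall>i j. (i, j) \<in> (E k)\<^sup>*) \<and>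
          order 0 (charpoly (Lap k)) = 1 \<and>
          vec 1 v* Lap k = 0 \<and>
          spectral_norm (mat 1 - averaging_matrix - Lap k) \<le> \<sigma>)"

definition algorithm_run ::
    "real \<Rightarrow> real \<Rightarrow> real \<Rightarrow> real \<Rightarrow> ('n::finite \<Rightarrow> real ^ 'd \<Rightarrow> real) \<Rightarrow> (nat \<Rightarrow> real ^ 'n ^ 'n) \<Rightarrow>
     (nat \<Rightarrow> 'n \<Rightarrow> real ^ 'd) \<Rightarrow> (nat \<Rightarrow> 'n \<Rightarrow> real ^ 'd) \<Rightarrow> (nat \<Rightarrow> 'n \<Rightarrow> real ^ 'd) \<Rightarrow>
     (nat \<Rightarrow> 'n \<Rightarrow> real ^ 'd) \<Rightarrow> (nat \<Rightarrow> 'n \<Rightarrow> real ^ 'd) \<Rightarrow> bool" where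
  "algorithm_run \<alpha> \<beta> \<gamma> \<delta> f Lap x w v y u \<longleftrightarrow>
     (\<Sum>i\<in>UNIV. w 0 i) = 0 \<and>
     (\<forall>k i. v k i = (\<Sum>j\<in>UNIV. Lap k $ i $ j *\<^sub>R x k j) \<and>
            y k i = x k i - \<delta> *\<^sub>R v k i \<and>
            u k i = grad (f i) (y k i) \<and>
            x (Suc k) i = x k i + \<beta> *\<^sub>R w k i - \<alpha> *\<^sub>R u k i - \<gamma> *\<^sub>R v k i \<and>
            w (Suc k) i = w k i - v k i)"

end

theory Submission
  imports Defs
begin

text \<open>
  Measure \<open>x\<close> and \<open>w\<close> from the fixed point and split them into their mean over the agents and the
  disagreement \<open>X i - mean X\<close>. The mean of \<open>w\<close> stays \<open>0\<close>, and since \<open>\<delta> = 1\<close> the graph assumption says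
  that passing from \<open>x\<close> to \<open>y\<close> keeps the mean and contracts the disagreement by \<open>\<sigma>\<close>. Put
  \<open>z = \<alpha> (u - u_opt) - (y - y_opt)\<close>. As \<open>\<alpha> m = 1 - \<rho>\<close> and \<open>\<alpha> L = 1 + \<rho> - \<eta>\<close>, the function assumption is
  \<open>(z + \<rho> y) \<bullet> (z - (\<rho> - \<eta>) y) \<le> 0\<close>, and as \<open>\<gamma> = 1 + \<beta>\<close> the iteration is
  \<open>w' = w - x + y\<close>, \<open>x' = \<beta> w' - z\<close>. A quadratic Lyapunov function with disagreement part
  \<open>A |x|^2 + C |w - x|^2\<close> decreases by the factor \<open>\<rho>^2\<close> in each step: the term in \<open>x\<close> is cancelled by the
  multiple \<open>\<mu> (\<sigma>^2 |x|^2 - |y|^2)\<close> of the contraction when \<open>\<mu> \<sigma>^2 = \<rho>^2 A\<close>, and the remaining form in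
  \<open>(w', y, z)\<close> is minus a square. Solving for \<open>A\<close>, \<open>C\<close>, \<open>\<mu>\<close> turns \<open>\<sigma>^2 = \<rho>^2 A / \<mu>\<close> into
  the constraint on the parameters.
\<close>

section \<open>Coefficients of the Lyapunov function\<close>

text \<open>The last four equations are what \<open>disagreement_step\<close> needs to complete a
  square. The sign constraint makes \<open>A\<close>, \<open>C\<close> and \<open>\<tau>\<close>
  positive, and \<open>0 < \<beta>\<close> is what the fixed point of \<open>w\<close>
  requires.\<close>

lemma certificate_parameters:
  fixes \<beta> \<rho> \<eta> \<sigma> :: real
  defines "\<epsilon> \<equiv> \<beta> - 1 + \<rho>\<^sup>2"
    and "D \<equiv> 2 * \<rho>\<^sup>2 * \<beta> - (1 - \<rho>\<^sup>2) * \<eta>"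
    and "N2 \<equiv> 2 - \<eta> - 2 * \<beta>"
    and "N3 \<equiv> (2 * \<rho>\<^sup>2 + \<eta>) * \<beta> - (1 - \<rho>\<^sup>2) * \<eta>"
    and "D3 \<equiv> (1 + \<rho>) * (\<eta> - 2 * \<eta> * \<rho> + 2 * \<rho>\<^sup>2) - (2 * \<rho>\<^sup>2 + \<eta>) * \<beta>"
  assumes \<rho>: "0 < \<rho>" "\<rho> < 1" and \<eta>: "0 \<le> \<eta>" "\<eta> < 2 * \<rho>"
    and sgn: "N2 * \<epsilon> > 0"
    and nz: "\<beta> - 1 + \<rho> \<noteq> 0" "D3 \<noteq> 0"
    and \<sigma>: "\<rho>\<^sup>2 * (\<epsilon> / (\<beta> - 1 + \<rho>)) * (N2 / D) * (N3 / D3) = \<sigma>\<^sup>2"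
  obtains A C \<mu> \<tau> where "0 < A" "0 < C" "0 < \<mu>" "0 < \<tau>" "\<mu> * \<sigma>\<^sup>2 = \<rho>\<^sup>2 * A" "0 < \<beta>"
    "\<tau> * (\<rho>\<^sup>2 * C - A * \<beta>\<^sup>2 - C * (1 - \<beta>)\<^sup>2) = \<rho>^4 * C\<^sup>2"
    "2 * \<tau> * (A * \<beta> - C * (1 - \<beta>)) = - \<rho>\<^sup>2 * C * \<eta>"
    "4 * \<tau> * (1 - A - C) = \<eta>\<^sup>2"
    "\<mu> = \<tau> - \<rho>\<^sup>2 * C + \<rho> * (\<rho> - \<eta>)"
proof -
  have \<rho>2: "0 < \<rho>\<^sup>2" "\<rho>\<^sup>2 < 1"
    using \<rho> by (auto simp: power_less_one_iff)
  have \<eta>2: "\<eta>\<^sup>2 < 4 * \<rho>\<^sup>2"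
    using power_strict_mono[of \<eta> "2 * \<rho>" 2] \<eta> by (simp add: power_mult_distrib)
  have "0 < \<epsilon> \<and> 0 < N2 \<or> \<epsilon> < 0 \<and> N2 < 0"
    using sgn by (auto simp: zero_less_mult_iff)
  then have signs: "0 < \<beta> \<and> 0 < N2 / D \<and> 0 < D / \<epsilon> \<and> 0 < N3"
  proof
    assume pos: "0 < \<epsilon> \<and> 0 < N2"
    have \<beta>: "0 < \<beta>" using pos \<rho>2 by (simp add: \<epsilon>_def)
    \<comment> \<open>\<open>2 * \<rho>\<^sup>2 - \<eta> = N2 + 2 * \<epsilon>\<close> has the
      common sign of \<open>N2\<close> and \<open>\<epsilon>\<close>, and \<open>D\<close> is this
      product plus \<open>2 * \<rho>\<^sup>2 * \<epsilon>\<close>. Hence \<open>D\<close> has that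
      sign too, in both cases.\<close>
    have "(1 - \<rho>\<^sup>2) * (2 * \<rho>\<^sup>2 - \<eta>) > 0"
      using pos \<rho>2 by (simp add: \<epsilon>_def N2_def)
    moreover have "2 * \<rho>\<^sup>2 * \<epsilon> > 0"
      using pos \<rho>2 by simp
    ultimately have D: "0 < D"
      by (simp add: D_def \<epsilon>_def algebra_simps)
    have "N3 = D + \<beta> * \<eta>" by (simp add: N3_def D_def algebra_simps)
    then have "0 < N3" using D \<beta> \<eta> by (simp add: add_pos_nonneg)
    then show ?thesis using \<beta> D pos by simp
  next
    assume neg: "\<epsilon> < 0 \<and> N2 < 0"
    have \<beta>: "0 < \<beta>" using neg \<eta> \<rho> by (simp add: N2_def)
    have "(1 - \<rho>\<^sup>2) * (2 * \<rho>\<^sup>2 - \<eta>) < 0"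
      using neg \<rho>2 by (simp add: \<epsilon>_def N2_def mult_less_0_iff)
    moreover have "2 * \<rho>\<^sup>2 * \<epsilon> < 0"
      using neg \<rho>2 by (simp add: mult_less_0_iff)
    ultimately have D: "D < 0"
      by (simp add: D_def \<epsilon>_def algebra_simps)
    \<comment> \<open>With \<open>D < 0\<close> the identity
      \<open>N3 = D + \<beta> * \<eta>\<close> no longer decides the sign, so \<open>N3\<close> is
      expressed through \<open>N2\<close> instead.\<close>
    have "2 * N3 = 4 * \<rho>\<^sup>2 - \<eta>\<^sup>2 - (2 * \<rho>\<^sup>2 + \<eta>) * N2"
      by (simp add: N3_def N2_def power2_eq_square algebra_simps)
    moreover have "(2 * \<rho>\<^sup>2 + \<eta>) * N2 < 0"
      using neg \<rho>2 \<eta> by (simp add: mult_less_0_iff add_pos_nonneg)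
    ultimately have "0 < N3" using \<eta>2 by linarith
    then show ?thesis using \<beta> D neg by (simp add: divide_neg_neg)
  qed
  then have nz': "\<epsilon> \<noteq> 0" "D \<noteq> 0" "\<rho> \<noteq> 0" "N3 \<noteq> 0" "N2 \<noteq> 0"
    using \<rho> by auto
  \<comment> \<open>eliminating \<open>A\<close> and \<open>C\<close> from the coefficient equations in the conclusion leaves a quadratic equation
    for \<open>\<tau>\<close> without constant term, whose nonzero root is rational in the parameters\<close>
  define \<tau> where "\<tau> = \<rho>\<^sup>2 * (D / \<epsilon>) / 2"
  define C where "C = N3 / (2 * \<rho>\<^sup>2)"
  define A where "A = N3 * (N2 / D) / 2"
  \<comment> \<open>In this closed form the constraint reads
    \<open>\<mu> * \<sigma>\<^sup>2 = \<rho>\<^sup>2 * A\<close>; agreement with the required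
    formula for \<open>\<mu>\<close> is \<open>h4\<close>.\<close>
  define \<mu> where "\<mu> = (\<beta> - 1 + \<rho>) * D3 / (2 * \<epsilon>)"
  have "0 < \<rho>\<^sup>2 * (D / \<epsilon>)" "0 < N3 * (N2 / D)"
    by (simp_all only: mult_pos_pos signs \<rho>2)
  then have pos: "0 < \<tau>" "0 < A" "0 < C"
    using signs \<rho>2 by (simp_all only: \<tau>_def A_def half_gt_zero_iff) (simp add: C_def)
  have \<mu>\<sigma>: "\<mu> * \<sigma>\<^sup>2 = \<rho>\<^sup>2 * A"
  proof -
    define \<theta> where "\<theta> = \<beta> - 1 + \<rho>"
    then have "\<theta> \<noteq> 0" using nz by simp
    then show ?thesis
      unfolding \<sigma>[symmetric] \<mu>_def A_def \<theta>_def[symmetric] using nz nz' by (simp add: field_simps)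
  qed
  \<comment> \<open>the right-hand side is positive, so the constraint rules out \<open>\<sigma> = 0\<close>\<close>
  then have "0 < \<mu> * \<sigma>\<^sup>2" using pos \<rho>2 by simp
  then have \<mu>: "0 < \<mu>"
    by (simp add: zero_less_mult_iff not_less)
  have t: "2 * \<epsilon> * \<tau> = \<rho>\<^sup>2 * D" and c: "2 * \<rho>\<^sup>2 * C = N3" and a: "2 * D * A = N3 * N2"
    and mu: "2 * \<epsilon> * \<mu> = (\<beta> - 1 + \<rho>) * D3"
    using nz' by (simp_all add: \<tau>_def C_def A_def \<mu>_def)
  have AC: "D * A = \<rho>\<^sup>2 * N2 * C"
    using a unfolding c[symmetric] by simp
  have eq2: "D * (A * \<beta> - C * (1 - \<beta>)) = - \<eta> * \<epsilon> * C"
  proof -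
    have "D * (A * \<beta> - C * (1 - \<beta>)) = \<beta> * (D * A) - D * C * (1 - \<beta>)"
      by (simp add: algebra_simps)
    also have "\<dots> = - \<eta> * \<epsilon> * C"
      unfolding AC unfolding D_def N2_def \<epsilon>_def by (simp add: power2_eq_square algebra_simps)
    finally show ?thesis .
  qed
  have h2: "2 * \<tau> * (A * \<beta> - C * (1 - \<beta>)) = - \<rho>\<^sup>2 * C * \<eta>"
  proof -
    have "2 * \<tau> * (A * \<beta> - C * (1 - \<beta>)) = \<rho>\<^sup>2 / \<epsilon> * (D * (A * \<beta> - C * (1 - \<beta>)))"
      by (simp add: \<tau>_def)
    then show ?thesis unfolding eq2 using nz' by simp
  qed
  have h1: "\<tau> * (\<rho>\<^sup>2 * C - A * \<beta>\<^sup>2 - C * (1 - \<beta>)\<^sup>2) = \<rho>^4 * C\<^sup>2"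
  proof -
    \<comment> \<open>Splitting off \<open>\<beta>\<close> times the left side of \<open>h2\<close>
      removes \<open>A\<close>; since (1 - \<beta>)^2 + \<beta> (1 - \<beta>) = 1 - \<beta>, the
      remaining factor of \<open>C\<close> is \<open>\<epsilon>\<close>.\<close>
    have "2 * \<tau> * (\<rho>\<^sup>2 * C - A * \<beta>\<^sup>2 - C * (1 - \<beta>)\<^sup>2)
        = 2 * \<epsilon> * \<tau> * C - \<beta> * (2 * \<tau> * (A * \<beta> - C * (1 - \<beta>)))"
      by (simp add: \<epsilon>_def power2_eq_square algebra_simps)
    also have "\<dots> = \<rho>\<^sup>2 * N3 * C"
      unfolding h2 t unfolding N3_def D_def by (simp add: power2_eq_square algebra_simps)
    also have "\<dots> = 2 * (\<rho>^4 * C\<^sup>2)"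
      unfolding c[symmetric] by (simp add: power2_eq_square power4_eq_xxxx)
    finally show ?thesis by simp
  qed
  have h3: "4 * \<tau> * (1 - A - C) = \<eta>\<^sup>2"
  proof -
    have "2 * D * \<rho>\<^sup>2 * (1 - A - C) = 2 * D * \<rho>\<^sup>2 - \<rho>\<^sup>2 * (2 * D * A) - D * (2 * \<rho>\<^sup>2 * C)"
      by (simp add: algebra_simps)
    also have "\<dots> = \<eta>\<^sup>2 * \<epsilon>"
      unfolding a c unfolding D_def N2_def N3_def \<epsilon>_def by (simp add: power2_eq_square algebra_simps)
    finally have "2 * D * \<rho>\<^sup>2 * (1 - A - C) = \<eta>\<^sup>2 * \<epsilon>" .
    then show ?thesis using nz' unfolding \<tau>_def by (simp add: field_simps)
  qed
  have "2 * \<epsilon> * \<mu> = 2 * \<epsilon> * \<tau> - \<epsilon> * (2 * \<rho>\<^sup>2 * C) + 2 * \<epsilon> * \<rho> * (\<rho> - \<eta>)"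
    unfolding mu t c unfolding D3_def D_def N3_def \<epsilon>_def by (simp add: power2_eq_square algebra_simps)
  then have "2 * \<epsilon> * \<mu> = 2 * \<epsilon> * (\<tau> - \<rho>\<^sup>2 * C + \<rho> * (\<rho> - \<eta>))"
    by (simp add: algebra_simps)
  then have h4: "\<mu> = \<tau> - \<rho>\<^sup>2 * C + \<rho> * (\<rho> - \<eta>)"
    using nz' by simp
  show thesis
    by (rule that[OF pos(2,3) \<mu> pos(1) \<mu>\<sigma> _ h1 h2 h3 h4]) (use signs in simp)
qed

section \<open>One-step estimates for disagreement and mean\<close>

text \<open>Here \<open>t\<close> stands for the new \<open>w\<close> and \<open>h\<close> for the
  old \<open>w - x\<close>. The left side minus the right, times \<open>4 * \<tau>\<close>, is minus
  the squared norm of \<open>(2 * \<tau>) *\<^sub>R y - (2 * \<rho>\<^sup>2 * C) *\<^sub>R t +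
  \<eta> *\<^sub>R z\<close>; the hypotheses match the coefficients of the inner products.\<close>

lemma disagreement_step:
  fixes t y z x h :: "'a::real_inner" and A C \<mu> \<tau> \<beta> \<rho> \<eta> \<sigma> :: real
  assumes \<tau>: "0 < \<tau>"
    and tt: "\<tau> * (\<rho>\<^sup>2 * C - A * \<beta>\<^sup>2 - C * (1 - \<beta>)\<^sup>2) = \<rho>^4 * C\<^sup>2"
    and tz: "2 * \<tau> * (A * \<beta> - C * (1 - \<beta>)) = - \<rho>\<^sup>2 * C * \<eta>"
    and zz: "4 * \<tau> * (1 - A - C) = \<eta>\<^sup>2"
    and yy: "\<mu> = \<tau> - \<rho>\<^sup>2 * C + \<rho> * (\<rho> - \<eta>)"
    and \<sigma>: "\<mu> * \<sigma>\<^sup>2 = \<rho>\<^sup>2 * A"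
    and t: "t = h + y"
  shows "A * (norm (\<beta> *\<^sub>R t - z))\<^sup>2 + C * (norm (t - (\<beta> *\<^sub>R t - z)))\<^sup>2
    \<le> \<rho>\<^sup>2 * (A * (norm x)\<^sup>2 + C * (norm h)\<^sup>2) + \<mu> * ((norm y)\<^sup>2 - \<sigma>\<^sup>2 * (norm x)\<^sup>2)
        + (z + \<rho> *\<^sub>R y) \<bullet> (z - (\<rho> - \<eta>) *\<^sub>R y)"
proof -
  have h: "h = t - y" using t by simp
  have \<sigma>': "\<mu> * ((norm y)\<^sup>2 - \<sigma>\<^sup>2 * (norm x)\<^sup>2) = \<mu> * (norm y)\<^sup>2 - \<rho>\<^sup>2 * A * (norm x)\<^sup>2"
    using \<sigma> by (simp add: algebra_simps)
  let ?lhs = "A * (norm (\<beta> *\<^sub>R t - z))\<^sup>2 + C * (norm (t - (\<beta> *\<^sub>R t - z)))\<^sup>2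
      - \<rho>\<^sup>2 * C * (norm h)\<^sup>2 - \<mu> * (norm y)\<^sup>2 - (z + \<rho> *\<^sub>R y) \<bullet> (z - (\<rho> - \<eta>) *\<^sub>R y)"
  have "4 * \<tau> * ?lhs =
      - 4 * (\<tau> * (\<rho>\<^sup>2 * C - A * \<beta>\<^sup>2 - C * (1 - \<beta>)\<^sup>2)) * (t \<bullet> t)
      - 4 * (2 * \<tau> * (A * \<beta> - C * (1 - \<beta>))) * (t \<bullet> z)
      - (4 * \<tau> * (1 - A - C)) * (z \<bullet> z)
      + 8 * \<tau> * \<rho>\<^sup>2 * C * (t \<bullet> y)
      - 4 * \<tau> * (\<mu> + \<rho>\<^sup>2 * C - \<rho> * (\<rho> - \<eta>)) * (y \<bullet> y)
      - 4 * \<tau> * \<eta> * (z \<bullet> y)"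
    unfolding h power2_norm_eq_inner
    by (simp add: inner_diff inner_add inner_commute power2_eq_square algebra_simps)
  also have "\<dots> = - (norm ((2 * \<tau>) *\<^sub>R y - (2 * \<rho>\<^sup>2 * C) *\<^sub>R t + \<eta> *\<^sub>R z))\<^sup>2"
    unfolding tt tz zz yy power2_norm_eq_inner
    by (simp add: inner_diff inner_add inner_commute power2_eq_square power4_eq_xxxx algebra_simps)
  also have "\<dots> \<le> 0" by simp
  finally have "?lhs \<le> 0"
    using \<tau> by (simp add: mult_le_0_iff)
  then show ?thesis
    unfolding \<sigma>' by (simp add: algebra_simps)
qed

text \<open>Averaging reduces the iteration to x' = - z with y = x. The weight is chosen so that the
  gap between the two sides is \<open>\<eta> / (2 * \<rho>)\<close> times the square of
  \<open>norm (z + \<rho> *\<^sub>R y)\<close>.\<close>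

lemma mean_step:
  fixes y z :: "'a::real_inner" and \<rho> \<eta> :: real
  assumes "0 < \<rho>" "0 \<le> \<eta>"
  shows "(1 - \<eta> / (2 * \<rho>)) * (norm z)\<^sup>2
    \<le> \<rho>\<^sup>2 * ((1 - \<eta> / (2 * \<rho>)) * (norm y)\<^sup>2) + (z + \<rho> *\<^sub>R y) \<bullet> (z - (\<rho> - \<eta>) *\<^sub>R y)"
proof -
  define q where "q = \<eta> / (2 * \<rho>)"
  have \<eta>: "\<eta> = 2 * \<rho> * q" and q: "0 \<le> q" using assms by (simp_all add: q_def)
  have "\<rho>\<^sup>2 * ((1 - q) * (norm y)\<^sup>2) + (z + \<rho> *\<^sub>R y) \<bullet> (z - (\<rho> - \<eta>) *\<^sub>R y) - (1 - q) * (norm z)\<^sup>2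
    = q * ((z + \<rho> *\<^sub>R y) \<bullet> (z + \<rho> *\<^sub>R y))"
    unfolding \<eta> power2_norm_eq_inner
    by (simp add: inner_diff inner_add inner_commute power2_eq_square algebra_simps)
  also have "\<dots> \<ge> 0" using q by simp
  finally show ?thesis by (simp add: q_def)
qed

section \<open>Averages over the agents and contraction of the disagreement\<close>

definition mean :: "('n::finite \<Rightarrow> 'a::real_vector) \<Rightarrow> 'a" where
  "mean p = (1 / real CARD('n)) *\<^sub>R (\<Sum>i\<in>UNIV. p i)"

lemma sum_eq_mean:
  fixes p :: "'n::finite \<Rightarrow> 'a::real_vector"
  shows "(\<Sum>i\<in>UNIV. p i) = real CARD('n) *\<^sub>R mean p"
  by (simp add: mean_def)

lemma mean_add: "mean (\<lambda>i. p i + q i) = mean p + mean q"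
  and mean_diff: "mean (\<lambda>i. p i - q i) = mean p - mean q"
  and mean_scaleR: "mean (\<lambda>i. c *\<^sub>R p i) = c *\<^sub>R mean p"
  by (simp_all add: mean_def sum.distrib sum_subtractf scaleR_right_distrib scaleR_right_diff_distrib
      scaleR_sum_right[symmetric] scaleR_left_commute)

lemma mean_const: "mean (\<lambda>_. c) = c"
  by (simp add: mean_def sum_constant_scaleR del: sum_constant)

text \<open>Deviations from the mean sum to zero, so the cross terms vanish. This splits the summed
  sector inequality into a mean part and a disagreement part.\<close>

lemma sum_inner_centered:
  fixes p q :: "'n::finite \<Rightarrow> 'a::real_inner"
  shows "(\<Sum>i\<in>UNIV. p i \<bullet> q i)
    = real CARD('n) * (mean p \<bullet> mean q) + (\<Sum>i\<in>UNIV. (p i - mean p) \<bullet> (q i - mean q))"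
  by (simp add: inner_diff sum.distrib sum_subtractf sum_eq_mean
      inner_sum_left[symmetric] inner_sum_right[symmetric])

text \<open>The rows of \<open>M\<close> sum to zero, so \<open>M\<close> sees only deviations from
  the mean, and averaging annihilates these. Thus the matrix with the norm bound sends
  \<open>X i - mean X\<close> to \<open>X i - mean X - v i\<close>. The bound is applied to each
  coordinate \<open>c\<close> of all agents together, then summed over \<open>c\<close>.\<close>

lemma contraction:
  fixes M :: "real ^ 'n::finite ^ 'n" and X v :: "'n \<Rightarrow> real ^ 'd::finite"
  assumes zero: "M *v vec 1 = 0"
    and norm: "spectral_norm (mat 1 - averaging_matrix - M) \<le> \<sigma>"
    and v: "\<And>i. v i = (\<Sum>j\<in>UNIV. M $ i $ j *\<^sub>R X j)"
  shows "(\<Sum>i\<in>UNIV. (norm (X i - mean X - v i))\<^sup>2) \<le> \<sigma>\<^sup>2 * (\<Sum>i\<in>UNIV. (norm (X i - mean X))\<^sup>2)"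
proof -
  let ?B = "mat 1 - averaging_matrix - M"
  have rows: "(\<Sum>j\<in>UNIV. M $ i $ j) = 0" for i
    using zero by (simp add: matrix_vector_mult_def vec_eq_iff)
  have coord: "(\<Sum>i\<in>UNIV. ((X i - mean X - v i) $ c)\<^sup>2) \<le> \<sigma>\<^sup>2 * (\<Sum>i\<in>UNIV. ((X i - mean X) $ c)\<^sup>2)" for c
  proof -
    define \<xi> :: "real ^ 'n" where "\<xi> = (\<chi> i. (X i - mean X) $ c)"
    have mean0: "(\<Sum>j\<in>UNIV. X j $ c - mean X $ c) = 0"
      using arg_cong[OF sum_eq_mean[of X], of "\<lambda>w. w $ c"] by (simp add: sum_subtractf)
    have "(M *v \<xi>) $ i = v i $ c" for i
      using rows[of i]
      by (simp add: matrix_vector_mult_def \<xi>_def v right_diff_distrib sum_subtractf sum_distrib_right[symmetric])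
    moreover have "(averaging_matrix *v \<xi>) $ i = 0" for i
      using mean0 by (simp add: matrix_vector_mult_def averaging_matrix_def \<xi>_def sum_divide_distrib[symmetric])
    ultimately have B: "(?B *v \<xi>) $ i = (X i - mean X - v i) $ c" for i
      by (simp add: matrix_vector_mult_diff_rdistrib \<xi>_def)
    have "norm (?B *v \<xi>) \<le> onorm (\<lambda>x. ?B *v x) * norm \<xi>"
      by (rule onorm[OF matrix_vector_mul_bounded_linear])
    also have "\<dots> \<le> \<sigma> * norm \<xi>"
      using norm by (simp add: spectral_norm_def mult_right_mono)
    finally have "(norm (?B *v \<xi>))\<^sup>2 \<le> (\<sigma> * norm \<xi>)\<^sup>2"
      by (rule power_mono) simp
    moreover have "(norm (?B *v \<xi>))\<^sup>2 = (\<Sum>i\<in>UNIV. ((X i - mean X - v i) $ c)\<^sup>2)"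
      unfolding power2_norm_eq_inner inner_vec_def B by (simp add: power2_eq_square)
    moreover have "(norm \<xi>)\<^sup>2 = (\<Sum>i\<in>UNIV. ((X i - mean X) $ c)\<^sup>2)"
      unfolding power2_norm_eq_inner inner_vec_def by (simp add: \<xi>_def power2_eq_square)
    ultimately show ?thesis by (simp add: power_mult_distrib)
  qed
  have swap: "(\<Sum>i\<in>UNIV. (norm (g i :: real ^ 'd))\<^sup>2) = (\<Sum>c\<in>UNIV. \<Sum>i\<in>UNIV. (g i $ c)\<^sup>2)" for g :: "'n \<Rightarrow> _"
    unfolding power2_norm_eq_inner inner_vec_def by (subst sum.swap) (simp add: power2_eq_square)
  show ?thesis
    unfolding swap by (subst sum_distrib_left) (rule sum_mono[OF coord])
qed

section \<open>The optimizer\<close>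

text \<open>Expanding the sector condition bounds (m + L) times the inner product of gradient
  increment and displacement from \<open>y\<close> below by a positive quantity. Hence the total
  cost strictly increases along every ray from \<open>y\<close>; this monotonicity relative to
  \<open>y\<close> takes the place of convexity.\<close>

lemma minimizer:
  fixes f :: "'n::finite \<Rightarrow> real ^ 'd::finite \<Rightarrow> real"
  assumes "0 < m" "m < L" and fa: "function_assumption m L f y"
  shows "{z. is_arg_min (\<lambda>z. (1 / real CARD('n)) * (\<Sum>i\<in>UNIV. f i z)) (\<lambda>_. True) z} = {y}"
proof -
  have gd: "GDERIV (f i) z :> grad (f i) z" for i z
    using fa grad_eqI unfolding function_assumption_def continuously_differentiable_def by metis
  have sum0: "(\<Sum>i\<in>UNIV. grad (f i) y) = 0"
    and sector: "(grad (f i) z - grad (f i) y - m *\<^sub>R (z - y)) \<bullet> (grad (f i) z - grad (f i) y - L *\<^sub>R (z - y)) \<le> 0" for i z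
    using fa unfolding function_assumption_def by auto
  have mono: "(grad (f i) z - grad (f i) y) \<bullet> (z - y) > 0" if "z \<noteq> y" for i z
  proof -
    let ?g = "grad (f i) z - grad (f i) y" and ?e = "z - y"
    have "(m + L) * (g \<bullet> e) = g \<bullet> g + m * L * (e \<bullet> e) - (g - m *\<^sub>R e) \<bullet> (g - L *\<^sub>R e)"
      for g e :: "real ^ 'd"
      by (simp add: inner_diff inner_commute algebra_simps)
    note this[of ?g ?e]
    moreover have "0 < m * L * (?e \<bullet> ?e)" using assms that by simp
    ultimately have "0 < (m + L) * (?g \<bullet> ?e)" using sector[of i z] inner_ge_zero[of ?g] by linarith
    then show ?thesis using assms by (simp add: zero_less_mult_iff)
  qed
  have less: "(\<Sum>i\<in>UNIV. f i y) < (\<Sum>i\<in>UNIV. f i z)" if z: "z \<noteq> y" for z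
  proof -
    let ?\<phi> = "\<lambda>s. \<Sum>i\<in>UNIV. f i (y + s *\<^sub>R (z - y))"
    let ?\<phi>' = "\<lambda>s. \<Sum>i\<in>UNIV. grad (f i) (y + s *\<^sub>R (z - y)) \<bullet> (z - y)"
    have "(?\<phi> has_real_derivative ?\<phi>' s) (at s)" for s
    proof (rule DERIV_sum)
      fix i
      have "((\<lambda>s. y + s *\<^sub>R (z - y)) has_derivative (\<lambda>s. s *\<^sub>R (z - y))) (at s)"
        by (auto intro!: derivative_eq_intros)
      from has_derivative_compose[OF this gd[of i, unfolded gderiv_def]]
      show "((\<lambda>s. f i (y + s *\<^sub>R (z - y))) has_real_derivative
          grad (f i) (y + s *\<^sub>R (z - y)) \<bullet> (z - y)) (at s)"
        unfolding has_field_derivative_def by (simp add: inner_commute mult_commute_abs)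
    qed
    then obtain s where s: "0 < s" "?\<phi> 1 - ?\<phi> 0 = ?\<phi>' s"
      using MVT2[of 0 1 ?\<phi> ?\<phi>'] by auto
    \<comment> \<open>At this point \<open>mono\<close> speaks of the displacement
      \<open>s *\<^sub>R (z - y)\<close>, whose factor \<open>s > 0\<close> drops out.\<close>
    have "0 < (grad (f i) (y + s *\<^sub>R (z - y)) - grad (f i) y) \<bullet> (z - y)" for i
      using mono[of "y + s *\<^sub>R (z - y)" i] z s(1) by (simp add: zero_less_mult_iff)
    then have "0 < (\<Sum>i\<in>UNIV. (grad (f i) (y + s *\<^sub>R (z - y)) - grad (f i) y) \<bullet> (z - y))"
      by (intro sum_pos) auto
    also have "\<dots> = ?\<phi>' s"
      using sum0 by (simp add: inner_diff_left sum_subtractf inner_sum_left[symmetric])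
    finally show ?thesis using s by simp
  qed
  define F where "F = (\<lambda>z. (1 / real CARD('n)) * (\<Sum>i\<in>UNIV. f i z))"
  have "F y < F z" if "z \<noteq> y" for z
    using less[OF that] by (simp add: F_def divide_strict_right_mono)
  then have "is_arg_min F (\<lambda>_. True) z \<longleftrightarrow> z = y" for z
    unfolding is_arg_min_def by (metis less_asym)
  then show ?thesis by (simp add: F_def)
qed

section \<open>The Lyapunov function of the network\<close>

text \<open>Only \<open>X\<close> is centered because \<open>W\<close> has mean zero wherever this
  is applied. The factor \<open>CARD('n)\<close> gives the mean the weight it has in
  \<open>sum_inner_centered\<close>.\<close>

definition lyapunov :: "real \<Rightarrow> real \<Rightarrow> real \<Rightarrow> ('n::finite \<Rightarrow> 'a::real_inner) \<Rightarrow> ('n \<Rightarrow> 'a) \<Rightarrow> real" where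
  "lyapunov p A C X W = p * (real CARD('n) * (norm (mean X))\<^sup>2)
     + (\<Sum>i\<in>UNIV. A * (norm (X i - mean X))\<^sup>2 + C * (norm (W i - (X i - mean X)))\<^sup>2)"

text \<open>\<open>mean_step\<close>, weighted by the number of agents, is added to
  \<open>disagreement_step\<close> summed over the agents. The sector terms recombine to the sum in
  \<open>sector\<close>, and \<open>contr\<close> with \<open>\<mu> > 0\<close> disposes of the
  \<open>\<mu>\<close> term.\<close>

lemma lyapunov_decrease:
  fixes X Y W X' W' v z :: "'n::finite \<Rightarrow> 'a::real_inner"
  assumes \<rho>: "0 < \<rho>" and \<eta>: "0 \<le> \<eta>" and \<mu>: "0 < \<mu>" and \<tau>: "0 < \<tau>"
    and cert: "\<tau> * (\<rho>\<^sup>2 * C - A * \<beta>\<^sup>2 - C * (1 - \<beta>)\<^sup>2) = \<rho>^4 * C\<^sup>2"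
      "2 * \<tau> * (A * \<beta> - C * (1 - \<beta>)) = - \<rho>\<^sup>2 * C * \<eta>"
      "4 * \<tau> * (1 - A - C) = \<eta>\<^sup>2"
      "\<mu> = \<tau> - \<rho>\<^sup>2 * C + \<rho> * (\<rho> - \<eta>)"
      "\<mu> * \<sigma>\<^sup>2 = \<rho>\<^sup>2 * A"
    and Y: "Y = (\<lambda>i. X i - v i)" and W': "W' = (\<lambda>i. W i - v i)"
    and X': "X' = (\<lambda>i. \<beta> *\<^sub>R W' i - z i)"
    and mean0: "mean v = 0" "mean W = 0"
    and contr: "(\<Sum>i\<in>UNIV. (norm (X i - mean X - v i))\<^sup>2) \<le> \<sigma>\<^sup>2 * (\<Sum>i\<in>UNIV. (norm (X i - mean X))\<^sup>2)"
    and sector: "(\<Sum>i\<in>UNIV. (z i + \<rho> *\<^sub>R Y i) \<bullet> (z i - (\<rho> - \<eta>) *\<^sub>R Y i)) \<le> 0"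
  shows "lyapunov (1 - \<eta> / (2 * \<rho>)) A C X' W' \<le> \<rho>\<^sup>2 * lyapunov (1 - \<eta> / (2 * \<rho>)) A C X W"
proof -
  define p where "p = 1 - \<eta> / (2 * \<rho>)"
  define S where "S z y = (z + \<rho> *\<^sub>R y) \<bullet> (z - (\<rho> - \<eta>) *\<^sub>R y)" for z y :: 'a
  let ?n = "real CARD('n)"
  let ?x = "\<lambda>i. X i - mean X" and ?y = "\<lambda>i. X i - mean X - v i" and ?z = "\<lambda>i. z i - mean z"
  have meanY: "mean Y = mean X" and meanX': "mean X' = - mean z"
    by (simp_all add: Y X' W' mean_diff mean_scaleR mean0)
  \<comment> \<open>Only this total is known to be nonpositive, so the estimates of the mean and of
    the disagreement carry their \<open>S\<close> terms along until they are added.\<close>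
  have S_split: "?n * S (mean z) (mean X) + (\<Sum>i\<in>UNIV. S (?z i) (?y i)) \<le> 0"
  proof -
    have "(\<Sum>i\<in>UNIV. (z i + \<rho> *\<^sub>R Y i) \<bullet> (z i - (\<rho> - \<eta>) *\<^sub>R Y i))
        = ?n * S (mean z) (mean X) + (\<Sum>i\<in>UNIV. S (?z i) (?y i))"
      unfolding sum_inner_centered[of "\<lambda>i. z i + \<rho> *\<^sub>R Y i"] mean_add mean_diff mean_scaleR meanY S_def
      by (simp add: Y algebra_simps)
    then show ?thesis using sector by simp
  qed
  have "p * (norm (mean z))\<^sup>2 \<le> \<rho>\<^sup>2 * (p * (norm (mean X))\<^sup>2) + S (mean z) (mean X)"
    unfolding p_def S_def by (rule mean_step[OF \<rho> \<eta>])
  then have "?n * (p * (norm (mean z))\<^sup>2) \<le> ?n * (\<rho>\<^sup>2 * (p * (norm (mean X))\<^sup>2) + S (mean z) (mean X))"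
    by (rule mult_left_mono) simp
  then have avg: "p * (?n * (norm (mean X'))\<^sup>2) \<le> \<rho>\<^sup>2 * (p * (?n * (norm (mean X))\<^sup>2)) + ?n * S (mean z) (mean X)"
    by (simp add: meanX' algebra_simps)
  have "A * (norm (X' i - mean X'))\<^sup>2 + C * (norm (W' i - (X' i - mean X')))\<^sup>2
      \<le> \<rho>\<^sup>2 * (A * (norm (?x i))\<^sup>2 + C * (norm (W i - ?x i))\<^sup>2)
        + \<mu> * ((norm (?y i))\<^sup>2 - \<sigma>\<^sup>2 * (norm (?x i))\<^sup>2) + S (?z i) (?y i)" for i
  proof -
    have "X' i - mean X' = \<beta> *\<^sub>R W' i - ?z i" unfolding meanX' by (simp add: X')
    moreover have "W' i = (W i - ?x i) + ?y i" by (simp add: W')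
    ultimately show ?thesis
      using disagreement_step[OF \<tau> cert, of "W' i" "W i - ?x i" "?y i" "?z i" "?x i"]
      by (simp add: S_def)
  qed
  then have "(\<Sum>i\<in>UNIV. A * (norm (X' i - mean X'))\<^sup>2 + C * (norm (W' i - (X' i - mean X')))\<^sup>2)
      \<le> (\<Sum>i\<in>UNIV. \<rho>\<^sup>2 * (A * (norm (?x i))\<^sup>2 + C * (norm (W i - ?x i))\<^sup>2)
        + \<mu> * ((norm (?y i))\<^sup>2 - \<sigma>\<^sup>2 * (norm (?x i))\<^sup>2) + S (?z i) (?y i))"
    by (rule sum_mono)
  also have "\<dots> = \<rho>\<^sup>2 * (\<Sum>i\<in>UNIV. A * (norm (?x i))\<^sup>2 + C * (norm (W i - ?x i))\<^sup>2)
        + \<mu> * ((\<Sum>i\<in>UNIV. (norm (?y i))\<^sup>2) - \<sigma>\<^sup>2 * (\<Sum>i\<in>UNIV. (norm (?x i))\<^sup>2)) + (\<Sum>i\<in>UNIV. S (?z i) (?y i))"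
    by (simp only: sum.distrib sum_subtractf sum_distrib_left[symmetric])
  also have "\<dots> \<le> \<rho>\<^sup>2 * (\<Sum>i\<in>UNIV. A * (norm (?x i))\<^sup>2 + C * (norm (W i - ?x i))\<^sup>2)
        + (\<Sum>i\<in>UNIV. S (?z i) (?y i))"
    using contr \<mu> by (simp add: mult_le_0_iff)
  finally show ?thesis
    using avg S_split by (simp add: lyapunov_def p_def[symmetric] distrib_left)
qed

text \<open>\<open>X i - v i\<close> is \<open>mean X\<close> plus the contracted deviation. The
  weights \<open>p\<close> and \<open>A\<close> control the former and the deviation of
  \<open>X\<close>; as \<open>\<sigma> \<le> 1\<close>, \<open>contr\<close> carries the latter
  bound over to the contracted deviation.\<close>

lemma norm_le_lyapunov:
  fixes X W v :: "'n::finite \<Rightarrow> 'a::real_inner"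
  assumes pos: "0 < p" "0 < A" "0 < C" and \<sigma>: "0 \<le> \<sigma>" "\<sigma> \<le> 1"
    and contr: "(\<Sum>i\<in>UNIV. (norm (X i - mean X - v i))\<^sup>2) \<le> \<sigma>\<^sup>2 * (\<Sum>i\<in>UNIV. (norm (X i - mean X))\<^sup>2)"
  shows "norm (X i - v i) \<le> (1 / sqrt p + 1 / sqrt A) * sqrt (lyapunov p A C X W)"
proof -
  let ?V = "lyapunov p A C X W"
  let ?D = "\<Sum>i\<in>UNIV. (norm (X i - mean X))\<^sup>2"
  have "p * (real CARD('n) * (norm (mean X))\<^sup>2) + A * ?D \<le> ?V"
    unfolding lyapunov_def sum.distrib sum_distrib_left[symmetric]
    using pos by (simp add: sum_nonneg)
  moreover have "(norm (mean X))\<^sup>2 \<le> real CARD('n) * (norm (mean X))\<^sup>2"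
    by (simp add: mult_le_cancel_right1 Suc_le_eq)
  then have "p * (norm (mean X))\<^sup>2 \<le> p * (real CARD('n) * (norm (mean X))\<^sup>2)"
    using pos by simp
  moreover have "(norm (X i - mean X - v i))\<^sup>2 \<le> ?D"
  proof -
    have "(norm (X i - mean X - v i))\<^sup>2 \<le> (\<Sum>i\<in>UNIV. (norm (X i - mean X - v i))\<^sup>2)"
      by (rule member_le_sum) auto
    also note contr
    also have "\<sigma>\<^sup>2 * ?D \<le> ?D"
      using \<sigma> by (simp add: mult_left_le_one_le power_le_one sum_nonneg)
    finally show ?thesis .
  qed
  then have "A * (norm (X i - mean X - v i))\<^sup>2 \<le> A * ?D"
    using pos by simp
  moreover have "0 \<le> A * ?D" "0 \<le> p * (real CARD('n) * (norm (mean X))\<^sup>2)"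
    using pos by (simp_all add: sum_nonneg)
  ultimately have "p * (norm (mean X))\<^sup>2 \<le> ?V" "A * (norm (X i - mean X - v i))\<^sup>2 \<le> ?V"
    by linarith+
  then have "(norm (mean X))\<^sup>2 \<le> ?V / p" "(norm (X i - mean X - v i))\<^sup>2 \<le> ?V / A"
    using pos by (simp_all add: field_simps)
  then have "norm (mean X) \<le> sqrt ?V / sqrt p" "norm (X i - mean X - v i) \<le> sqrt ?V / sqrt A"
    by (simp_all add: real_le_rsqrt real_sqrt_divide[symmetric])
  moreover have "norm (X i - v i) \<le> norm (mean X) + norm (X i - mean X - v i)"
    using norm_triangle_ineq[of "mean X" "X i - mean X - v i"] by simp
  ultimately show ?thesis by (simp add: distrib_right)
qed

section \<open>Convergence of the iterates at rate \<rho>\<close>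

theorem theorem12:
  fixes f :: "'n::finite \<Rightarrow> real ^ 'd::finite \<Rightarrow> real"
    and y_opt :: "real ^ 'd"
    and E :: "nat \<Rightarrow> ('n \<times> 'n) set"
    and Lap :: "nat \<Rightarrow> real ^ 'n ^ 'n"
    and x w v y u :: "nat \<Rightarrow> 'n \<Rightarrow> real ^ 'd"
    and m L \<sigma> \<kappa> \<eta> \<rho> \<alpha> \<beta> \<gamma> \<delta> :: real
  assumes "0 < m" and "m < L" and "0 \<le> \<sigma>" and "\<sigma> < 1"
    and "function_assumption m L f y_opt"
    and "graph_assumption \<sigma> E Lap"
    and "\<kappa> = L / m"
    and "\<eta> = 1 + \<rho> - \<kappa> * (1 - \<rho>)"
    and "\<alpha> = (1 - \<rho>) / m" and "\<gamma> = 1 + \<beta>" and "\<delta> = 1"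
    and "(L - m) / (L + m) \<le> \<rho>" and "\<rho> < 1"
    and "(2 * \<beta> - (1 - \<rho>) * (\<kappa> + 1)) * (\<beta> - 1 + \<rho>\<^sup>2) < 0"
    and "\<beta> - 1 + \<rho> \<noteq> 0"
    and "2 * \<rho>\<^sup>2 * \<beta> - (1 - \<rho>\<^sup>2) * \<eta> \<noteq> 0"
    and "(1 + \<rho>) * (\<eta> - 2 * \<eta> * \<rho> + 2 * \<rho>\<^sup>2) - (2 * \<rho>\<^sup>2 + \<eta>) * \<beta> \<noteq> 0"
    and "\<rho>\<^sup>2 * ((\<beta> - 1 + \<rho>\<^sup>2) / (\<beta> - 1 + \<rho>))
            * ((2 - \<eta> - 2 * \<beta>) / (2 * \<rho>\<^sup>2 * \<beta> - (1 - \<rho>\<^sup>2) * \<eta>))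
            * (((2 * \<rho>\<^sup>2 + \<eta>) * \<beta> - (1 - \<rho>\<^sup>2) * \<eta>)
               / ((1 + \<rho>) * (\<eta> - 2 * \<eta> * \<rho> + 2 * \<rho>\<^sup>2) - (2 * \<rho>\<^sup>2 + \<eta>) * \<beta>))
         = \<sigma>\<^sup>2"
    and "algorithm_run \<alpha> \<beta> \<gamma> \<delta> f Lap x w v y u"
  shows "{z. is_arg_min (\<lambda>z. (1 / real CARD('n)) * (\<Sum>i\<in>UNIV. f i z)) (\<lambda>_. True) z} = {y_opt} \<and>
         (\<exists>c>0. \<forall>i k. norm (y k i - y_opt) \<le> c * \<rho> ^ k)"
proof
  show "{z. is_arg_min (\<lambda>z. (1 / real CARD('n)) * (\<Sum>i\<in>UNIV. f i z)) (\<lambda>_. True) z} = {y_opt}"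
    by (rule minimizer) (use assms in auto)
  have m: "0 < m" "m < L" by fact+
  have \<kappa>: "\<kappa> = L / m" and \<eta>_def: "\<eta> = 1 + \<rho> - \<kappa> * (1 - \<rho>)" and \<alpha>: "\<alpha> = (1 - \<rho>) / m" by fact+
  have \<alpha>m: "\<alpha> * m = 1 - \<rho>" and \<alpha>L: "\<alpha> * L = 1 + \<rho> - \<eta>"
    using m by (simp_all add: \<alpha> \<eta>_def \<kappa>)
  have \<rho>_lb: "(L - m) / (L + m) \<le> \<rho>" and \<rho>1: "\<rho> < 1" by fact+
  moreover have "0 < (L - m) / (L + m)" using m by simp
  ultimately have \<rho>0: "0 < \<rho>" by linarith
  \<comment> \<open>The lower bound on \<open>\<rho>\<close> amounts to
    \<open>0 \<le> \<eta>\<close>, and \<open>m < L\<close> to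
    \<open>\<eta> < 2 * \<rho>\<close>.\<close>
  have "L * (1 - \<rho>) \<le> m * (1 + \<rho>)"
    using \<rho>_lb m by (simp add: field_simps)
  then have \<eta>0: "0 \<le> \<eta>" using m by (simp add: \<eta>_def \<kappa> field_simps)
  have "m * (1 - \<rho>) < L * (1 - \<rho>)" using m \<rho>1 by simp
  then have \<eta>\<rho>: "\<eta> < 2 * \<rho>" using m by (simp add: \<eta>_def \<kappa> field_simps)
  have "(2 - \<eta> - 2 * \<beta>) * (\<beta> - 1 + \<rho>\<^sup>2) > 0"
  proof -
    have "2 - \<eta> - 2 * \<beta> = - (2 * \<beta> - (1 - \<rho>) * (\<kappa> + 1))" by (simp add: \<eta>_def algebra_simps)
    then show ?thesis using assms(14) by (simp only: mult_minus_left)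
  qed
  then obtain A C \<mu> \<tau> where pos: "0 < A" "0 < C" "0 < \<mu>" "0 < \<tau>" and \<mu>\<sigma>: "\<mu> * \<sigma>\<^sup>2 = \<rho>\<^sup>2 * A"
    and \<beta>0: "0 < \<beta>"
    and cert: "\<tau> * (\<rho>\<^sup>2 * C - A * \<beta>\<^sup>2 - C * (1 - \<beta>)\<^sup>2) = \<rho>^4 * C\<^sup>2"
      "2 * \<tau> * (A * \<beta> - C * (1 - \<beta>)) = - \<rho>\<^sup>2 * C * \<eta>"
      "4 * \<tau> * (1 - A - C) = \<eta>\<^sup>2"
      "\<mu> = \<tau> - \<rho>\<^sup>2 * C + \<rho> * (\<rho> - \<eta>)"
    using certificate_parameters[OF \<rho>0 \<rho>1 \<eta>0 \<eta>\<rho> _ assms(15,17,18)] by blast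
  have run: "(\<Sum>i\<in>UNIV. w 0 i) = 0" "v k i = (\<Sum>j\<in>UNIV. Lap k $ i $ j *\<^sub>R x k j)"
      "y k i = x k i - v k i" "u k i = grad (f i) (y k i)"
      "x (Suc k) i = x k i + \<beta> *\<^sub>R w k i - \<alpha> *\<^sub>R u k i - (1 + \<beta>) *\<^sub>R v k i"
      "w (Suc k) i = w k i - v k i" for k i
    using assms(10,11,19) unfolding algorithm_run_def by auto
  have graph: "Lap k *v vec 1 = 0" "vec 1 v* Lap k = 0"
      "spectral_norm (mat 1 - averaging_matrix - Lap k) \<le> \<sigma>" for k
    using assms(6) unfolding graph_assumption_def associated_laplacian_def by auto
  define g where "g i = grad (f i) y_opt" for i
  have g0: "(\<Sum>i\<in>UNIV. g i) = 0"
    and sector: "(grad (f i) z - g i - m *\<^sub>R (z - y_opt)) \<bullet> (grad (f i) z - g i - L *\<^sub>R (z - y_opt)) \<le> 0" for i z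
    using assms(5) unfolding function_assumption_def g_def by auto
  have cols: "(\<Sum>i\<in>UNIV. Lap k $ i $ j) = 0" for k j
    using graph(2)[of k] by (simp add: vector_matrix_mult_def vec_eq_iff)
  have sum_v: "(\<Sum>i\<in>UNIV. v k i) = 0" for k
    unfolding run by (subst sum.swap) (simp add: scaleR_left.sum[symmetric] cols)
  have sum_w: "(\<Sum>i\<in>UNIV. w k i) = 0" for k
    by (induction k) (simp_all add: run(1,6) sum_subtractf sum_v)
  define X where "X k i = x k i - y_opt" for k i
  \<comment> \<open>At the fixed point \<open>v = 0\<close> and \<open>u = g\<close>, so a
    stationary \<open>x\<close> forces \<open>\<beta> w = \<alpha> g\<close>. Since \<open>g\<close>
    sums to zero, the shift preserves the zero mean.\<close>
  define W where "W k i = w k i - (\<alpha> / \<beta>) *\<^sub>R g i" for k i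
  define z where "z k i = \<alpha> *\<^sub>R (u k i - g i) - (y k i - y_opt)" for k i
  have mean_v: "mean (v k) = 0" and mean_W: "mean (W k) = 0" for k
    by (simp_all add: mean_def W_def sum_v sum_w g0 sum_subtractf scaleR_sum_right[symmetric])
  have "X k = (\<lambda>i. x k i - y_opt)" for k
    by (simp add: X_def fun_eq_iff)
  then have "mean (X k) = mean (x k) - y_opt" for k
    by (simp add: mean_diff mean_const)
  then have X_centered: "X k i - mean (X k) = x k i - mean (x k)" for k i
    by (simp add: X_def)
  have contr: "(\<Sum>i\<in>UNIV. (norm (X k i - mean (X k) - v k i))\<^sup>2) \<le> \<sigma>\<^sup>2 * (\<Sum>i\<in>UNIV. (norm (X k i - mean (X k)))\<^sup>2)" for k
    unfolding X_centered by (rule contraction[OF graph(1,3)]) (rule run(2))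
  define V where "V k = lyapunov (1 - \<eta> / (2 * \<rho>)) A C (X k) (W k)" for k
  have V_step: "V (Suc k) \<le> \<rho>\<^sup>2 * V k" for k
    unfolding V_def
  proof (rule lyapunov_decrease[OF \<rho>0 \<eta>0 pos(3,4) cert \<mu>\<sigma> refl _ _ mean_v mean_W contr])
    show W': "W (Suc k) = (\<lambda>i. W k i - v k i)"
      by (simp add: fun_eq_iff W_def run(6))
    show "X (Suc k) = (\<lambda>i. \<beta> *\<^sub>R W (Suc k) i - z k i)"
      using \<beta>0 by (simp add: fun_eq_iff W_def X_def z_def run(3,5,6) algebra_simps)
    have "(z k i + \<rho> *\<^sub>R (X k i - v k i)) \<bullet> (z k i - (\<rho> - \<eta>) *\<^sub>R (X k i - v k i)) \<le> 0" for i
    proof -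
      let ?e = "y k i - y_opt" and ?a = "u k i - g i"
      have e: "X k i - v k i = ?e" by (simp add: X_def run(3))
      have "z k i + \<rho> *\<^sub>R ?e = \<alpha> *\<^sub>R (?a - m *\<^sub>R ?e)"
        unfolding scaleR_right_diff_distrib[of \<alpha>] scaleR_scaleR \<alpha>m by (simp add: z_def algebra_simps)
      moreover have "z k i - (\<rho> - \<eta>) *\<^sub>R ?e = \<alpha> *\<^sub>R (?a - L *\<^sub>R ?e)"
        unfolding scaleR_right_diff_distrib[of \<alpha>] scaleR_scaleR \<alpha>L by (simp add: z_def algebra_simps)
      ultimately show ?thesis
        using sector[of i "y k i"] m \<rho>1 by (simp add: e run(4) \<alpha> divide_le_0_iff mult_le_0_iff)
    qed
    then show "(\<Sum>i\<in>UNIV. (z k i + \<rho> *\<^sub>R (X k i - v k i)) \<bullet> (z k i - (\<rho> - \<eta>) *\<^sub>R (X k i - v k i))) \<le> 0"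
      by (rule sum_nonpos)
  qed
  have V_le: "V k \<le> (\<rho>^k)\<^sup>2 * V 0" for k
  proof (induction k)
    case (Suc k)
    have "V (Suc k) \<le> \<rho>\<^sup>2 * ((\<rho>^k)\<^sup>2 * V 0)"
      using V_step[of k] mult_left_mono[OF Suc, of "\<rho>\<^sup>2"] by simp
    then show ?case by (simp add: power_mult_distrib mult.assoc)
  qed simp
  define K where "K = 1 / sqrt (1 - \<eta> / (2 * \<rho>)) + 1 / sqrt A"
  have p: "0 < 1 - \<eta> / (2 * \<rho>)" using \<eta>\<rho> \<rho>0 by simp
  then have K: "0 < K" using pos by (simp add: K_def add_pos_pos)
  have bound: "norm (y k i - y_opt) \<le> K * sqrt (V 0) * \<rho>^k" for i k
  proof -
    have "norm (X k i - v k i) \<le> K * sqrt (V k)"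
      unfolding K_def V_def
      by (rule norm_le_lyapunov[OF p pos(1,2) _ _ contr]) (use assms(3,4) in auto)
    also have "\<dots> \<le> K * sqrt ((\<rho>^k)\<^sup>2 * V 0)"
      using K V_le[of k] by simp
    finally show ?thesis
      using \<rho>0 by (simp add: X_def run(3) real_sqrt_mult mult_ac diff_diff_eq add.commute)
  qed
  \<comment> \<open>The added \<open>1\<close> keeps the constant positive when
    \<open>V 0 = 0\<close>.\<close>
  have "norm (y k i - y_opt) \<le> (K * sqrt (V 0) + 1) * \<rho>^k" for i k
    using bound[of k i] \<rho>0 by (simp add: distrib_right add_increasing2)
  moreover have "0 < K * sqrt (V 0) + 1"
  proof -
    \<comment> \<open>Read off from the bound at \<open>k = 0\<close> for an arbitrary agent, which
      dominates a norm.\<close>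
    have "0 \<le> K * sqrt (V 0)" using order_trans[OF norm_ge_zero bound[of 0 undefined]] by simp
    then show ?thesis by simp
  qed
  ultimately show "\<exists>c>0. \<forall>i k. norm (y k i - y_opt) \<le> c * \<rho>^k" by blast
qed

end
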